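(* Fix an odd prime $d$. (a) For each odd prime power $q=p^\alpha$ with $p \equiv 1 \pmod{d}$ and all integers $a,b$, the value $K(a,b,q,d)$ lies in $\mathbb{H}_d$. (b) Fix $\epsilon > 0$, $b \in \mathbb{Z}$, and $w\in \mathbb{H}_d$, and let $B_{\epsilon}(w)$ be the open ball of radius $\epsilon$ centered at $w$. Then for every sufficiently large odd prime power $q=p^\alpha$ with $p \equiv 1 \pmod{d}$, there exists $a \in \mathbb{Z}/q\mathbb{Z}$ such that $K(a,b,q,d) \in B_{\epsilon}(w)$.
   Context: Let $e(x)=\exp(2\pi i x)$. For an odd prime power $q$ and a positive divisor $d$ of $\phi(q)$ (Euler totient), $(\mathbb{Z}/q\mathbb{Z})^\times$ is cyclic and has a unique subgroup of order $d$, namely $\{u : u^d=1\}$; define the generalized Kloosterman sum $K(a,b,q,d)=\sum_{u\in(\mathbb{Z}/q\mathbb{Z})^\times,\ u^d=1} e\big(\frac{au+bu^{-1}}{q}\big)$, where $u^{-1}$ is the inverse of $u$ modulo $q$. $\mathbb{H}_d$ denotes the closure of the bounded region of $\mathbb{C}$ enclosed by the $d$-cusped hypocycloid $\theta\mapsto (d-1)e^{i\theta}+e^{(1-d)i\theta}$, $\theta\in[0,2\pi]$ (centered at $0$ with a cusp at $d$). *)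

theory Defs
  imports "HOL-Complex_Analysis.Complex_Analysis" "HOL-Number_Theory.Number_Theory"
begin

definition e :: "real \<Rightarrow> complex" where
  "e x = exp (2 * of_real pi * \<i> * of_real x)"

text \<open>
  The unit group of the integers modulo \<open>q\<close> is represented by the set \<^term>\<open>totatives q\<close> of
  residues in \<open>{1..q}\<close> coprime to \<open>q\<close>. The intended range is \<open>q\<close> an odd prime power and \<open>d\<close> a
  positive divisor of \<^term>\<open>totient q\<close>.
\<close>
definition kloosterman :: "int \<Rightarrow> int \<Rightarrow> nat \<Rightarrow> nat \<Rightarrow> complex" where
  "kloosterman a b q d =
     (\<Sum>u | u \<in> totatives q \<and> [u ^ d = 1] (mod q).
        e (of_int (a * int u + b * modular_inverse (int q) (int u)) / of_nat q))"

definition hypocycloid :: "nat \<Rightarrow> real \<Rightarrow> complex" where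
  "hypocycloid d \<theta> =
     (of_nat d - 1) * exp (\<i> * of_real \<theta>) + exp ((1 - of_nat d) * \<i> * of_real \<theta>)"

text \<open>
  For \<open>d \<ge> 3\<close> the hypocycloid is a simple closed curve, so that \<^const>\<open>inside\<close>, the union of
  the bounded components of the complement, is the one bounded region that it encloses.
\<close>
definition hypocycloid_region :: "nat \<Rightarrow> complex set" where
  "hypocycloid_region d = closure (inside (hypocycloid d ` {0..2 * pi}))"

end

theory Submission
  imports Defs "HOL-Computational_Algebra.Polynomial_Factorial"
begin

text \<open>
  Let \<open>S\<close> be the set of sums of \<open>d\<close> unit complex numbers with product \<open>1\<close>; both parts reduce to
  the fact that \<open>S\<close> is the closed region enclosed by the hypocycloid \<open>C\<close>.

  If \<open>x\<close> lies outside \<open>S\<close>, then a point of \<open>S\<close> nearest to \<open>x\<close> lies on \<open>C\<close>: rotating two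
  summands in opposite directions stays in \<open>S\<close>, and the first and second order conditions force
  all summands but one to coincide. Hence a connected open set that avoids \<open>C\<close> is contained in \<open>S\<close>
  or disjoint from \<open>S\<close>. The outside of \<open>C\<close> is unbounded, so it is disjoint from the compact set
  \<open>S\<close>; the point \<open>0\<close> is in \<open>S\<close> but not on \<open>C\<close>, so the inside of \<open>C\<close> is contained in \<open>S\<close>.

  If \<open>g\<close> generates the subgroup of order \<open>d\<close>, then \<open>1 + g + \<dots> + g\<^sup>d\<^sup>-\<^sup>1\<close> vanishes modulo \<open>q\<close>, so
  the \<open>d\<close> terms of the Kloosterman sum have product \<open>1\<close>. For the density statement, irreducibility
  of \<open>1 + X + \<dots> + X\<^sup>d\<^sup>-\<^sup>1\<close> shows that for large \<open>q\<close> no nontrivial relation with bounded coefficients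
  holds between \<open>1, g, \<dots>, g\<^sup>d\<^sup>-\<^sup>2\<close> modulo \<open>q\<close>. With \<open>n = d - 1\<close> and \<open>z\<^sub>k\<close> a fixed unit times
  \<open>e (a g\<^sup>k / q)\<close>, the mean over \<open>a\<close> of \<open>\<Prod>\<^sub>k \<bar>1 + z\<^sub>k\<bar>\<^sup>2\<^sup>M\<close> is then at least \<open>4\<^sup>M\<^sup>n / (M + 1)\<^sup>n\<close> by
  Parseval and Cauchy-Schwarz, and for large \<open>M\<close> this forces all \<open>z\<^sub>k\<close> to be close to \<open>1\<close> for some \<open>a\<close>.
\<close>

section \<open>The region enclosed by the hypocycloid\<close>

text \<open>For \<open>d > 0\<close> these are the traces of the matrices in SU(d), the summands
  being the eigenvalues.\<close>

definition unit_sums :: "nat \<Rightarrow> complex set" where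
  "unit_sums d = {\<Sum>k<d. z k | z. (\<forall>k<d. cmod (z k) = 1) \<and> (\<Prod>k<d. z k) = 1}"

lemma unit_sumsI:
  "(\<And>k. k < d \<Longrightarrow> cmod (z k) = 1) \<Longrightarrow> (\<Prod>k<d. z k) = 1 \<Longrightarrow> (\<Sum>k<d. z k) \<in> unit_sums d"
  unfolding unit_sums_def by blast

text \<open>Recording sum and product together makes induction possible: one more unit number gives
  a continuous image of a compact product. The closed condition that the product is 1 is imposed
  only afterwards.\<close>

lemma compact_sum_prod_pairs:
  "compact {(\<Sum>k<n. z k, \<Prod>k<n. z k) | z :: nat \<Rightarrow> complex. \<forall>k<n. cmod (z k) = 1}"
    (is "compact (?A n)")
proof (induction n)
  case 0
  have "?A 0 = {(0, 1)}" by auto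
  then show ?case by simp
next
  case (Suc n)
  let ?f = "\<lambda>(x, w::complex). (fst x + w, snd x * w)"
  have "?A (Suc n) = ?f ` (?A n \<times> sphere 0 1)"
  proof (intro equalityI subsetI)
    fix x assume "x \<in> ?A (Suc n)"
    then obtain z where z: "x = (\<Sum>k<Suc n. z k, \<Prod>k<Suc n. z k)" "\<forall>k<Suc n. cmod (z k) = 1"
      by blast
    have "x = ?f ((\<Sum>k<n. z k, \<Prod>k<n. z k), z n)" using z(1) by simp
    moreover have "((\<Sum>k<n. z k, \<Prod>k<n. z k), z n) \<in> ?A n \<times> sphere 0 1"
      using z(2) by auto
    ultimately show "x \<in> ?f ` (?A n \<times> sphere 0 1)" by (rule image_eqI)
  next
    fix x assume "x \<in> ?f ` (?A n \<times> sphere 0 1)"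
    then obtain z w where zw: "x = ((\<Sum>k<n. z k) + w, (\<Prod>k<n. z k) * w)"
      "\<forall>k<n. cmod (z k) = 1" "cmod w = 1"
      by auto
    have "x = (\<Sum>k<Suc n. (z(n := w)) k, \<Prod>k<Suc n. (z(n := w)) k)"
      using zw(1) by simp
    moreover have "\<forall>k<Suc n. cmod ((z(n := w)) k) = 1"
      using zw by (auto simp: less_Suc_eq)
    ultimately show "x \<in> ?A (Suc n)" by blast
  qed
  moreover have "compact (?f ` (?A n \<times> sphere 0 1))"
    by (intro compact_continuous_image compact_Times Suc.IH compact_sphere)
       (auto simp: case_prod_unfold intro!: continuous_intros)
  ultimately show ?case by simp
qed

lemma compact_unit_sums: "compact (unit_sums d)"
proof -
  let ?A = "{(\<Sum>k<d. z k, \<Prod>k<d. z k) | z :: nat \<Rightarrow> complex. \<forall>k<d. cmod (z k) = 1}"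
  have "unit_sums d = fst ` (?A \<inter> (UNIV \<times> {1}))"
    unfolding unit_sums_def by (auto simp: image_iff) force
  moreover have "compact (?A \<inter> (UNIV \<times> {1}))"
    by (intro compact_Int_closed compact_sum_prod_pairs closed_Times closed_UNIV closed_singleton)
  ultimately show ?thesis
    by (auto intro!: compact_continuous_image continuous_intros)
qed

section \<open>Nearest points of the set of unit sums\<close>

lemma sum_fun_upd2:
  fixes z :: "nat \<Rightarrow> 'a :: ab_group_add"
  assumes "j < d" "k < d" "j \<noteq> k"
  shows "(\<Sum>i<d. (z(j := a, k := b)) i) = (\<Sum>i<d. z i) + (a - z j) + (b - z k)"
proof -
  have *: "(\<Sum>i<d. f i) = f j + (f k + sum f ({..<d} - {j} - {k}))" for f :: "nat \<Rightarrow> 'a"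
    using assms by (simp add: sum.remove[of "{..<d}" j] sum.remove[of "{..<d} - {j}" k])
  have "sum (z(j := a, k := b)) ({..<d} - {j} - {k}) = sum z ({..<d} - {j} - {k})"
    by (intro sum.cong) auto
  then show ?thesis
    unfolding *[of z] *[of "z(j := a, k := b)"] using assms(3) by simp
qed

lemma prod_fun_upd2:
  fixes z :: "nat \<Rightarrow> 'a :: comm_monoid_mult"
  assumes "j < d" "k < d" "j \<noteq> k" "a * b = z j * z k"
  shows "(\<Prod>i<d. (z(j := a, k := b)) i) = (\<Prod>i<d. z i)"
proof -
  have *: "(\<Prod>i<d. f i) = f j * f k * prod f ({..<d} - {j} - {k})" for f :: "nat \<Rightarrow> 'a"
    using assms by (simp add: prod.remove[of "{..<d}" j] prod.remove[of "{..<d} - {j}" k] mult.assoc)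
  have "prod (z(j := a, k := b)) ({..<d} - {j} - {k}) = prod z ({..<d} - {j} - {k})"
    by (intro prod.cong) auto
  then show ?thesis
    unfolding *[of z] *[of "z(j := a, k := b)"] using assms(3,4) by simp
qed

text \<open>The vector \<open>g\<close> points from the nearest point \<open>\<Sum>k<d. z k\<close> of the set to \<open>x\<close>.\<close>
locale nearest_unit_sum =
  fixes d :: nat and x :: complex and z :: "nat \<Rightarrow> complex" and g :: complex
  assumes unit: "\<And>k. k < d \<Longrightarrow> cmod (z k) = 1"
    and prod: "(\<Prod>k<d. z k) = 1"
    and g_def: "g = x - (\<Sum>k<d. z k)"
    and g_nz: "g \<noteq> 0"
    and nearest: "\<And>s. s \<in> unit_sums d \<Longrightarrow> cmod g \<le> cmod (x - s)"
begin

text \<open>Replacing \<open>z j\<close>, \<open>z k\<close> by \<open>z j * cis t\<close>,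
  \<open>z k * cis (-t)\<close> keeps the product and shifts the sum by
  \<open>v = A * (cos t - 1) + B * sin t\<close>. Minimality gives
  \<open>cmod g \<le> cmod (g - v)\<close>; squaring and cancelling leaves the inequality.\<close>

lemma rotate_pair:
  assumes "j < d" "k < d" "j \<noteq> k"
  defines "A \<equiv> z j + z k" and "B \<equiv> \<i> * (z j - z k)"
  shows "2 * (Re (cnj g * A) * (cos t - 1) + Re (cnj g * B) * sin t)
          \<le> (Re A * (cos t - 1) + Re B * sin t)\<^sup>2 + (Im A * (cos t - 1) + Im B * sin t)\<^sup>2"
proof -
  define z' where "z' = z(j := z j * cis t, k := z k * cis (-t))"
  define v where "v = A * (cos t - 1) + B * sin t"
  have "(\<Sum>i<d. z' i) = (\<Sum>i<d. z i) + v"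
    unfolding z'_def v_def sum_fun_upd2[OF assms(1-3)] A_def B_def
    by (simp add: complex_eq_iff algebra_simps)
  moreover have "(\<Sum>i<d. z' i) \<in> unit_sums d"
  proof (rule unit_sumsI)
    show "cmod (z' i) = 1" if "i < d" for i
      using unit assms(1-3) that by (auto simp: z'_def norm_mult)
    have "z j * cis t * (z k * cis (-t)) = z j * z k * (cis t * cis (-t))"
      by (simp add: mult_ac)
    also have "\<dots> = z j * z k" by (simp add: cis_mult)
    finally show "(\<Prod>i<d. z' i) = 1"
      unfolding z'_def using prod prod_fun_upd2[OF assms(1-3)] by metis
  qed
  ultimately have "cmod g \<le> cmod (g - v)"
    using nearest[of "\<Sum>i<d. z' i"] by (simp add: g_def algebra_simps)
  hence "(cmod g)\<^sup>2 \<le> (cmod (g - v))\<^sup>2" by (simp add: power_mono)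
  hence "2 * (Re g * Re v + Im g * Im v) \<le> (Re v)\<^sup>2 + (Im v)\<^sup>2"
    unfolding cmod_power2 by (simp add: power2_eq_square algebra_simps)
  then show ?thesis
    by (simp add: v_def algebra_simps)
qed

text \<open>First-order condition: the difference \<open>h\<close> of the two sides of
  \<open>rotate_pair\<close> is maximal at \<open>t = 0\<close>, so its derivative
  \<open>2 * Re (cnj g * B)\<close> vanishes there.\<close>

lemma Im_eq:
  assumes "j < d" "k < d"
  shows "Im (cnj g * z j) = Im (cnj g * z k)"
proof (cases "j = k")
  case False
  define A where "A = z j + z k"
  define B where "B = \<i> * (z j - z k)"
  define h where "h = (\<lambda>t. 2 * (Re (cnj g * A) * (cos t - 1) + Re (cnj g * B) * sin t)
     - (Re A * (cos t - 1) + Re B * sin t)\<^sup>2 - (Im A * (cos t - 1) + Im B * sin t)\<^sup>2)"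
  have "(h has_real_derivative 2 * Re (cnj g * B)) (at 0)"
    unfolding h_def by (auto intro!: derivative_eq_intros)
  moreover have "h y \<le> h 0" for y
    using rotate_pair[OF assms False, of y] by (simp add: h_def A_def B_def)
  ultimately have "2 * Re (cnj g * B) = 0"
    using DERIV_local_max[of h _ 0 1] by auto
  then show ?thesis by (simp add: B_def algebra_simps)
qed auto

text \<open>Second-order condition: for \<open>z j = z k\<close> the term \<open>B\<close> vanishes,
  so the left side of \<open>rotate_pair\<close> is linear in \<open>1 - cos t\<close> and the right
  side quadratic. A negative real part would violate the inequality for small
  \<open>t\<close>.\<close>

lemma Re_nonneg:
  assumes "j < d" "k < d" "j \<noteq> k" "z j = z k"
  shows "Re (cnj g * z j) \<ge> 0"
proof (rule ccontr)
  define r where "r = Re (cnj g * z j)"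
  assume "\<not> ?thesis"
  hence r: "r < 0" by (simp add: r_def)
  \<comment> \<open>\<open>u\<close> is the value of \<open>1 - cos t\<close>: at most 1, so that
    the arccosine is defined, and below \<open>-r\<close>, against the bound
    \<open>- r \<le> u\<close> derived at the end.\<close>
  define u where "u = min 1 (-r/2)"
  have u: "0 < u" "u \<le> 1" "u < -r" using r by (auto simp: u_def min_def)
  define t where "t = arccos (1 - u)"
  have t: "cos t = 1 - u" using u by (simp add: t_def cos_arccos)
  have "(Re (z j))\<^sup>2 + (Im (z j))\<^sup>2 = 1"
    using unit[OF assms(1)] by (metis cmod_power2 one_power2)
  hence "(2 * Re (z j) * u)\<^sup>2 + (2 * Im (z j) * u)\<^sup>2 = 4 * u\<^sup>2"
    by (simp add: power_mult_distrib flip: distrib_left distrib_right)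
  moreover have "2 * ((2 * r) * (- u)) \<le> (2 * Re (z j) * u)\<^sup>2 + (2 * Im (z j) * u)\<^sup>2"
    using rotate_pair[OF assms(1-3), of t] assms(4) t by (simp add: r_def algebra_simps)
  ultimately have "4 * (- r) * u \<le> 4 * u * u" by (simp add: power2_eq_square)
  hence "- r * u \<le> u * u" by simp
  hence "- r \<le> u" using u(1) by (rule mult_right_le_imp_le)
  with u show False by simp
qed

text \<open>The numbers \<open>cnj g * z j\<close> share their modulus and, by \<open>Im_eq\<close>,
  their imaginary part, so the sign of the real part determines them.\<close>

lemma eq_if_Re_nonneg:
  assumes "j < d" "k < d" "Re (cnj g * z j) \<ge> 0" "Re (cnj g * z k) \<ge> 0"
  shows "z j = z k"
proof -
  have "(cmod (cnj g * z j))\<^sup>2 = (cmod (cnj g * z k))\<^sup>2"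
    using unit assms by (simp add: norm_mult)
  hence "(Re (cnj g * z j))\<^sup>2 = (Re (cnj g * z k))\<^sup>2"
    using Im_eq[OF assms(1,2)] unfolding cmod_power2 by simp
  hence "Re (cnj g * z j) = Re (cnj g * z k)"
    using assms(3,4) by (simp add: power2_eq_iff_nonneg)
  hence "cnj g * z j = cnj g * z k"
    using Im_eq[OF assms(1,2)] by (simp add: complex_eq_iff)
  thus ?thesis using g_nz by simp
qed

text \<open>Two distinct such indices would carry equal summands, which \<open>Re_nonneg\<close>
  forbids.\<close>

lemma eq_if_Re_neg:
  assumes "j < d" "k < d" "Re (cnj g * z j) < 0" "Re (cnj g * z k) < 0"
  shows "j = k"
proof (rule ccontr)
  assume "j \<noteq> k"
  have "(cmod (cnj g * z j))\<^sup>2 = (cmod (cnj g * z k))\<^sup>2"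
    using unit assms by (simp add: norm_mult)
  hence "(Re (cnj g * z j))\<^sup>2 = (Re (cnj g * z k))\<^sup>2"
    using Im_eq[OF assms(1,2)] unfolding cmod_power2 by simp
  hence "Re (cnj g * z j) = Re (cnj g * z k)"
    using assms(3,4) unfolding power2_eq_iff by linarith
  hence "cnj g * z j = cnj g * z k"
    using Im_eq[OF assms(1,2)] by (simp add: complex_eq_iff)
  hence "z j = z k" using g_nz by simp
  with Re_nonneg[OF assms(1,2) \<open>j \<noteq> k\<close>] assms(3) show False by simp
qed

lemma all_but_one_equal:
  assumes "d > 0"
  obtains k w where "k < d" "\<And>j. j < d \<Longrightarrow> j \<noteq> k \<Longrightarrow> z j = w" "cmod w = 1"
proof (cases "\<exists>k<d. Re (cnj g * z k) < 0")
  case True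
  then obtain k where k: "k < d" "Re (cnj g * z k) < 0" by blast
  have *: "Re (cnj g * z j) \<ge> 0" if "j < d" "j \<noteq> k" for j
    using eq_if_Re_neg[OF that(1) k(1) _ k(2)] that by force
  show ?thesis
  proof (cases "\<exists>i<d. i \<noteq> k")
    case True
    then obtain i where i: "i < d" "i \<noteq> k" by blast
    show ?thesis
      by (rule that[OF k(1), of "z i"]) (use * i eq_if_Re_nonneg unit in auto)
  next
    case False
    \<comment> \<open>There is no index besides \<open>k\<close>, so any unit number can serve as
      the common value.\<close>
    show ?thesis by (rule that[OF k(1), of 1]) (use False in auto)
  qed
next
  case False
  hence "z j = z 0" if "j < d" for j
    using eq_if_Re_nonneg[OF that assms] that assms not_less by blast
  then show ?thesis
    using that[OF assms, of "z 0"] unit assms by blast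
qed

text \<open>With \<open>w = exp (\<i> * t)\<close> the common value of the other summands, product 1
  forces the exceptional one to be \<open>w\<close> to the power \<open>1 - d\<close>; the sum is
  then the curve at parameter \<open>t\<close>.\<close>

lemma in_hypocycloid:
  assumes "d > 0"
  shows "(\<Sum>k<d. z k) \<in> hypocycloid d ` {0..2 * pi}"
proof -
  obtain k w where kw: "k < d" "\<And>j. j < d \<Longrightarrow> j \<noteq> k \<Longrightarrow> z j = w" "cmod w = 1"
    using all_but_one_equal[OF assms] by metis
  obtain t where t: "0 \<le> t" "t < 2 * pi" "w = exp (\<i> * of_real t)"
    using Arg2pi[of w] kw(3) that[of "Arg2pi w"] by (simp add: is_Arg_def)
  have c: "card ({..<d} - {k}) = d - 1" using kw(1) by simp
  have "(\<Prod>j<d. z j) = z k * (\<Prod>j\<in>{..<d} - {k}. w)"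
    using kw by (simp add: prod.remove[of "{..<d}" k])
  hence "z k * w ^ (d - 1) = 1" using prod c by (simp add: prod_constant)
  hence "z k = inverse (w ^ (d - 1))" by (metis inverse_unique mult.commute)
  also have "\<dots> = exp (- (of_nat (d - 1) * (\<i> * of_real t)))"
    unfolding exp_minus exp_of_nat_mult t(3) ..
  also have "- (of_nat (d - 1) * (\<i> * of_real t)) = (1 - of_nat d) * \<i> * of_real t"
    using assms by (simp add: of_nat_diff algebra_simps)
  finally have zk: "z k = exp ((1 - of_nat d) * \<i> * of_real t)" .
  have "(\<Sum>j<d. z j) = z k + (\<Sum>j\<in>{..<d} - {k}. w)"
    using kw by (simp add: sum.remove[of "{..<d}" k])
  also have "\<dots> = hypocycloid d t"
    unfolding hypocycloid_def sum_constant c zk t(3)[symmetric] using assms by (simp add: of_nat_diff)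
  finally show ?thesis using t by auto
qed

end

text \<open>If \<open>U\<close> left the set, it would contain a frontier point \<open>s\<close>. A
  point \<open>x\<close> outside the set and close to \<open>s\<close> has a nearest point
  \<open>y\<close> on the curve, and \<open>y\<close> is still close enough to \<open>s\<close> to
  lie in \<open>U\<close>.\<close>

lemma open_connected_unit_sums:
  assumes "d > 0" "open U" "connected U" "U \<inter> hypocycloid d ` {0..2 * pi} = {}"
    "U \<inter> unit_sums d \<noteq> {}"
  shows "U \<subseteq> unit_sums d"
proof (rule ccontr)
  assume "\<not> U \<subseteq> unit_sums d"
  hence "U \<inter> frontier (unit_sums d) \<noteq> {}"
    using connected_Int_frontier[OF assms(3,5)] by blast
  then obtain s where s: "s \<in> U" "s \<in> frontier (unit_sums d)" by blast
  obtain r where r: "r > 0" "ball s r \<subseteq> U" using assms(2) s(1) openE by blast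
  have "s \<in> closure (- unit_sums d)"
    using s(2) by (simp add: frontier_closures)
  then obtain x where x: "x \<notin> unit_sums d" "dist x s < r / 2"
    using r(1) closure_approachable[of s "- unit_sums d"] by (metis ComplD half_gt_zero)
  have cl: "closed (unit_sums d)" by (rule compact_imp_closed[OF compact_unit_sums])
  have "s \<in> unit_sums d" using s(2) cl frontier_subset_eq by blast
  then obtain y where y: "y \<in> unit_sums d" "\<And>v. v \<in> unit_sums d \<Longrightarrow> dist x y \<le> dist x v"
    using distance_attains_inf[OF cl, of x] by blast
  then obtain z where z: "y = (\<Sum>k<d. z k)" "\<forall>k<d. cmod (z k) = 1" "(\<Prod>k<d. z k) = 1"
    unfolding unit_sums_def by blast
  interpret nearest_unit_sum d x z "x - y"
    using x y z by unfold_locales (auto simp: dist_norm)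
  have "y \<in> hypocycloid d ` {0..2 * pi}"
    using in_hypocycloid[OF assms(1)] z(1) by simp
  moreover have "dist s y < r"
    using dist_triangle[of s y x] y(2)[OF \<open>s \<in> unit_sums d\<close>] x(2) by (simp add: dist_commute)
  hence "y \<in> U" using r(2) by auto
  ultimately show False using assms(4) by blast
qed

section \<open>The hypocycloid as a simple closed curve\<close>

text \<open>Equality case of the triangle inequality for \<open>n\<close> unit terms. The first two
  combine to \<open>u ^ m * (u + v)\<close>, so \<open>cmod (u + v) \<ge> 2\<close>, and the
  parallelogram law gives \<open>u = v\<close>.\<close>

lemma norm_power_sum_eq_imp:
  fixes u v :: complex
  assumes "cmod u = 1" "cmod v = 1" "n \<ge> 2"
    and "cmod (\<Sum>j<n. u ^ (n - Suc j) * v ^ j) = n"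
  shows "u = v"
proof -
  define m where "m = n - 2"
  have m: "n = Suc (Suc m)" using assms(3) by (simp add: m_def)
  have "(\<Sum>j<n. u ^ (n - Suc j) * v ^ j)
          = u ^ m * (u + v) + (\<Sum>j<m. u ^ (m - Suc j) * v ^ (Suc (Suc j)))"
    unfolding m sum.lessThan_Suc_shift by (simp add: algebra_simps)
  also have "cmod \<dots> \<le> cmod (u + v) + (\<Sum>j<m. 1)"
    using assms(1,2)
    by (intro order.trans[OF norm_triangle_ineq] add_mono order.trans[OF norm_sum] sum_mono)
       (auto simp: norm_mult norm_power)
  finally have "2 \<le> cmod (u + v)" using assms(4) m by simp
  hence "2\<^sup>2 \<le> (cmod (u + v))\<^sup>2" by (intro power_mono) auto
  moreover have "(cmod (u - v))\<^sup>2 = - (cmod (u + v))\<^sup>2 + 2 * (cmod u)\<^sup>2 + 2 * (cmod v)\<^sup>2"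
    unfolding cmod_power2 by (simp add: power2_eq_square algebra_simps)
  ultimately have "(cmod (u - v))\<^sup>2 \<le> 0" by (simp add: assms(1,2))
  thus ?thesis by simp
qed

lemma hypocycloid_eq_exp:
  assumes "d > 0"
  shows "hypocycloid d t
           = of_nat (d - 1) * exp (\<i> * of_real t) + cnj (exp (\<i> * of_real t) ^ (d - 1))"
proof -
  have "(1 - of_nat d) * \<i> * of_real t = cnj (of_nat (d - 1) * (\<i> * of_real t))"
    using assms by (simp add: of_nat_diff algebra_simps)
  hence "exp ((1 - of_nat d) * \<i> * of_real t) = cnj (exp (\<i> * of_real t) ^ (d - 1))"
    unfolding complex_cnj_power exp_cnj exp_of_nat_mult[symmetric] by (rule arg_cong)
  thus ?thesis using assms by (simp add: hypocycloid_def of_nat_diff)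
qed

text \<open>Equal values give \<open>n * cmod (u - v) = cmod (u ^ n - v ^ n)\<close>. Dividing by
  \<open>u - v\<close> leaves a sum of \<open>n\<close> unit terms of modulus \<open>n\<close>, the
  extremal case above.\<close>

lemma hypocycloid_inj:
  assumes "d \<ge> 3" "hypocycloid d s = hypocycloid d t"
  shows "exp (\<i> * of_real s) = exp (\<i> * of_real t)"
proof (rule ccontr)
  define u v n where "u = exp (\<i> * of_real s)" and "v = exp (\<i> * of_real t)" and "n = d - 1"
  have uv: "cmod u = 1" "cmod v = 1" by (auto simp: u_def v_def)
  assume "exp (\<i> * of_real s) \<noteq> exp (\<i> * of_real t)"
  hence "u \<noteq> v" by (simp add: u_def v_def)
  have "of_nat n * u + cnj (u ^ n) = of_nat n * v + cnj (v ^ n)"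
    using assms by (simp add: hypocycloid_eq_exp u_def v_def n_def)
  hence "of_nat n * (u - v) = - cnj (u ^ n - v ^ n)" by (simp add: algebra_simps)
  hence "cmod (of_nat n * (u - v)) = cmod (u ^ n - v ^ n)"
    by (metis complex_mod_cnj norm_minus_cancel)
  also have "u ^ n - v ^ n = (u - v) * (\<Sum>j<n. v ^ (n - Suc j) * u ^ j)"
    by (rule power_diff_sumr2)
  finally have "cmod (\<Sum>j<n. v ^ (n - Suc j) * u ^ j) = n"
    using \<open>u \<noteq> v\<close> by (simp add: norm_mult)
  moreover have "n \<ge> 2" using assms(1) by (simp add: n_def)
  ultimately show False using norm_power_sum_eq_imp[of v u n] uv \<open>u \<noteq> v\<close> by metis
qed

text \<open>The \<open>d\<close>-th roots of unity sum to 0, and their product is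
  \<open>w ^ (d * m)\<close> with \<open>m = (d - 1) / 2\<close>, an integer because
  \<open>d\<close> is odd.\<close>

lemma zero_in_unit_sums:
  assumes "d > 1" "odd d"
  shows "0 \<in> unit_sums d"
proof -
  obtain m where m: "d = 2 * m + 1" using assms(2) oddE by blast
  define w where "w = exp (2 * of_real pi * \<i> * of_nat 1 / of_nat d)"
  have w: "w ^ d = 1" "w \<noteq> 1"
    using complex_root_unity[of d 1] complex_root_unity_eq_1[of d 1] assms(1) by (auto simp: w_def)
  have "(\<Sum>k<d. w ^ k) \<in> unit_sums d"
  proof (rule unit_sumsI)
    show "cmod (w ^ k) = 1" for k by (simp add: w_def norm_power)
    have "(\<Sum>k<2 * m + 1. k) = (2 * m + 1) * m" by (induction m) auto
    hence "(\<Prod>k<d. w ^ k) = w ^ (d * m)" unfolding m power_sum[symmetric] by metis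
    thus "(\<Prod>k<d. w ^ k) = 1" by (simp add: power_mult w)
  qed
  moreover have "(\<Sum>k<d. w ^ k) = 0" using w by (simp add: sum_gp_strict)
  ultimately show ?thesis by simp
qed

lemma hypocycloid_region_eq_unit_sums:
  assumes "d \<ge> 3" "odd d"
  shows "hypocycloid_region d = unit_sums d"
proof -
  \<comment> \<open>The parameter is rescaled to the unit interval so that the Jordan curve theorem
    for simple closed paths applies.\<close>
  define c where "c = hypocycloid d \<circ> (\<lambda>t. 2 * pi * t)"
  define C where "C = hypocycloid d ` {0..2 * pi}"
  have "(\<lambda>t. 2 * pi * t) ` {0..1} = {0..2 * pi}"
    by (subst image_mult_atLeastAtMost) auto
  hence C: "path_image c = C"
    unfolding c_def C_def path_image_def image_comp[symmetric] by simp
  have "path c"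
    unfolding path_def c_def o_def hypocycloid_def by (intro continuous_intros)
  moreover have "x = y \<or> x = 0 \<and> y = 1 \<or> x = 1 \<and> y = 0"
    if "x \<in> {0..1}" "y \<in> {0..1}" "c x = c y" for x y
  proof -
    have "exp (\<i> * of_real (2 * pi * x)) = exp (\<i> * of_real (2 * pi * y))"
      using hypocycloid_inj[OF assms(1)] that unfolding c_def comp_def by blast
    then obtain n :: int where "\<i> * of_real (2 * pi * x)
        = \<i> * of_real (2 * pi * y) + of_real (real_of_int (2 * n) * pi) * \<i>"
      unfolding exp_eq by blast
    hence "Im (\<i> * of_real (2 * pi * x))
        = Im (\<i> * of_real (2 * pi * y) + of_real (real_of_int (2 * n) * pi) * \<i>)"
      by (rule arg_cong)
    hence "2 * pi * x = 2 * pi * y + 2 * n * pi" by simp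
    hence "2 * pi * x = 2 * pi * (y + n)" by (simp add: algebra_simps)
    hence n: "x = y + n" by simp
    hence "\<bar>real_of_int n\<bar> \<le> 1" using that by auto
    hence "n = 0 \<or> n = 1 \<or> n = -1" by linarith
    thus ?thesis using n that by auto
  qed
  ultimately have sp: "simple_path c"
    unfolding simple_path_def loop_free_def by blast
  have loop: "pathfinish c = pathstart c"
    using assms by (simp add: pathfinish_def pathstart_def c_def hypocycloid_eq_exp mult.commute[of \<i>])
  note J = Jordan_inside_outside[OF sp loop, unfolded C]
  have d: "d > 0" using assms by simp
  have dis: "outside C \<inter> C = {}" "inside C \<inter> C = {}"
    by (auto simp: outside_no_overlap inside_no_overlap)
  have out: "outside C \<inter> unit_sums d = {}"
  proof (rule ccontr)
    assume "\<not> ?thesis"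
    hence "outside C \<subseteq> unit_sums d"
      using open_connected_unit_sums[OF d, of "outside C"] J dis by (auto simp: C_def)
    thus False using J compact_imp_bounded[OF compact_unit_sums[of d]] bounded_subset by blast
  qed
  have "0 \<in> unit_sums d" by (rule zero_in_unit_sums[OF _ assms(2)]) (use assms in simp)
  moreover have "0 \<notin> C"
  proof
    assume "0 \<in> C"
    then obtain t where "hypocycloid d t = 0" by (auto simp: C_def)
    hence "of_nat (d - 1) * exp (\<i> * of_real t) = - cnj (exp (\<i> * of_real t) ^ (d - 1))"
      using d by (simp add: hypocycloid_eq_exp eq_neg_iff_add_eq_0)
    hence "cmod (of_nat (d - 1) * exp (\<i> * of_real t)) = 1"
      by (simp add: norm_power)
    hence "real (d - 1) = 1" unfolding norm_mult norm_of_nat by simp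
    thus False using assms(1) by simp
  qed
  ultimately have "0 \<in> inside C"
    using out inside_Un_outside[of C] by blast
  with \<open>0 \<in> unit_sums d\<close> have "inside C \<subseteq> unit_sums d"
    using open_connected_unit_sums[OF d, of "inside C"] J dis by (auto simp: C_def)
  hence 1: "closure (inside C) \<subseteq> unit_sums d"
    using compact_imp_closed[OF compact_unit_sums] closure_minimal by blast
  \<comment> \<open>Reverse inclusion: unit sums avoid the outside, so they lie inside
    \<open>C\<close> or on \<open>C\<close>, which is the frontier of its inside.\<close>
  have "C \<subseteq> closure (inside C)"
    using J by (auto simp: frontier_def)
  moreover have "inside C \<subseteq> closure (inside C)" by (rule closure_subset)
  ultimately have "unit_sums d \<subseteq> closure (inside C)"
    using out inside_Un_outside[of C] by blast
  with 1 show ?thesis by (auto simp: hypocycloid_region_def C_def)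
qed

section \<open>Independence of powers modulo \<open>q\<close>\<close>

text \<open>Eisenstein's argument: let \<open>i\<close> be the least index at which the coefficient
  of \<open>f\<close> is not divisible by \<open>p\<close>. In coefficient \<open>i\<close> of
  \<open>f * g\<close> every term but \<open>coeff f i * coeff g 0\<close> is divisible by
  \<open>p\<close>, so \<open>i\<close> cannot be below \<open>n\<close>.\<close>

lemma eisenstein_degree:
  fixes f g :: "int poly" and p :: int
  assumes "prime p" "\<And>i. i < n \<Longrightarrow> p dvd Polynomial.coeff (f * g) i" "lead_coeff (f * g) = 1"
    and "\<not> p dvd Polynomial.coeff g 0"
  shows "n \<le> degree f"
proof (rule ccontr)
  assume n: "\<not> n \<le> degree f"
  have unit: "lead_coeff f dvd 1"
    unfolding assms(3)[symmetric] lead_coeff_mult by (rule dvd_triv_left)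
  have "\<not> p dvd lead_coeff f"
  proof
    assume "p dvd lead_coeff f"
    hence "p dvd 1" using unit by (rule dvd_trans)
    thus False using assms(1) not_prime_unit[of p] by simp
  qed
  define i where "i = (LEAST i. \<not> p dvd Polynomial.coeff f i)"
  have i: "\<not> p dvd Polynomial.coeff f i" "i \<le> degree f"
    unfolding i_def using \<open>\<not> p dvd lead_coeff f\<close> by (rule LeastI, rule Least_le)
  have lt: "p dvd Polynomial.coeff f j" if "j < i" for j
    using that not_less_Least unfolding i_def by blast
  have "Polynomial.coeff (f * g) i = (\<Sum>j<i. Polynomial.coeff f j * Polynomial.coeff g (i - j))
      + Polynomial.coeff f i * Polynomial.coeff g 0"
    by (simp add: coeff_mult flip: lessThan_Suc_atMost)
  moreover have "p dvd (\<Sum>j<i. Polynomial.coeff f j * Polynomial.coeff g (i - j))"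
    by (rule dvd_sum, rule dvd_mult2, rule lt) simp
  moreover have "p dvd Polynomial.coeff (f * g) i" using assms(2) i(2) n by simp
  ultimately have "p dvd Polynomial.coeff f i * Polynomial.coeff g 0" by (simp add: dvd_add_right_iff)
  with assms(1,4) i(1) show False by (simp add: prime_dvd_mult_iff)
qed

lemma geometric_poly_mult:
  "[:-1, 1:] * (\<Sum>k<d. Polynomial.monom 1 k) = (Polynomial.monom 1 d - 1 :: 'a :: comm_ring_1 poly)"
proof (induction d)
  case (Suc d)
  have "[:-1, 1:] * Polynomial.monom 1 d
          = (Polynomial.monom 1 (Suc d) - Polynomial.monom 1 d :: 'a poly)"
    by (simp add: monom_Suc)
  then show ?case
    unfolding sum.lessThan_Suc distrib_left Suc.IH by simp
qed simp

lemma pcompose_monom: "pcompose (Polynomial.monom a n) p = Polynomial.smult a (p ^ n)"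
  for p :: "'a :: comm_semiring_1 poly"
proof (induction n)
  case (Suc n)
  have "pcompose (Polynomial.monom a (Suc n)) p = p * pcompose (Polynomial.monom a n) p"
    by (simp add: monom_Suc pcompose_pCons)
  then show ?case unfolding Suc.IH by simp
qed (simp add: monom_0)

lemma degree_geometric_poly:
  "d > 0 \<Longrightarrow> degree (\<Sum>k<d. Polynomial.monom 1 k :: 'a :: comm_ring_1 poly) = d - 1"
proof (rule antisym)
  let ?f = "\<Sum>k<d. Polynomial.monom 1 k :: 'a poly"
  assume "d > 0"
  thus "degree ?f \<le> d - 1"
    by (intro degree_sum_le order.trans[OF degree_monom_le]) auto
  have "Polynomial.coeff ?f (d - 1) = 1"
    using \<open>d > 0\<close> by (simp add: coeff_sum)
  thus "d - 1 \<le> degree ?f" by (intro le_degree) simp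
qed

text \<open>Substituting \<open>X + 1\<close> in \<open>(X - 1) * f = X ^ d - 1\<close> turns the
  factor \<open>X - 1\<close> into \<open>X\<close>, which accounts for the index
  \<open>Suc i\<close>.\<close>

lemma coeff_geometric_poly_shift:
  "Polynomial.coeff (pcompose (\<Sum>k<d. Polynomial.monom 1 k) [:1, 1:]) i
     = (of_nat (d choose Suc i) :: 'a :: comm_ring_1)"
proof -
  let ?f = "(\<Sum>k<d. Polynomial.monom 1 k) :: 'a poly"
  have "pCons 0 (pcompose ?f [:1, 1:]) = pcompose ([:-1, 1:] * ?f) [:1, 1:]"
    unfolding pcompose_mult by (simp add: pcompose_pCons)
  also have "\<dots> = [:1, 1:] ^ d - 1"
    unfolding geometric_poly_mult by (simp add: pcompose_diff pcompose_monom pcompose_1)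
  finally have "pCons 0 (pcompose ?f [:1, 1:]) = [:1, 1:] ^ d - 1" .
  hence "Polynomial.coeff (pCons 0 (pcompose ?f [:1, 1:])) (Suc i)
           = Polynomial.coeff ([:1, 1:] ^ d - 1) (Suc i)"
    by (rule arg_cong)
  hence *: "Polynomial.coeff (pcompose ?f [:1, 1:]) i = Polynomial.coeff ([:1, 1:] ^ d) (Suc i)"
    by simp
  show ?thesis
  proof (cases "Suc i \<le> d")
    case True
    thus ?thesis using * by (simp add: coeff_linear_poly_power)
  next
    case False
    moreover have "degree ([:1, 1:] ^ d :: 'a poly) \<le> d"
      using degree_power_le[of "[:1, 1:] :: 'a poly" d] by simp
    ultimately show ?thesis using * by (simp add: coeff_eq_0 binomial_eq_0)
  qed
qed

text \<open>Eisenstein at \<open>d\<close> after shifting \<open>X\<close> to \<open>X + 1\<close>.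
  As \<open>d * d\<close> does not divide the constant term \<open>d\<close>, some factor has
  constant term prime to \<open>d\<close>; the other then has full degree, and the first is constant
  with unit leading coefficient.\<close>

lemma irreducible_geometric_poly:
  assumes "prime d"
  shows "irreducible (\<Sum>k<d. Polynomial.monom 1 k :: int poly)"
proof (rule irreducibleI)
  let ?f = "\<Sum>k<d. Polynomial.monom 1 k :: int poly"
  define g where "g = pcompose ?f [:1, 1:]"
  have d: "d \<ge> 2" using assms prime_ge_2_nat by blast
  have deg: "degree ?f = d - 1" using d by (simp add: degree_geometric_poly)
  thus "?f \<noteq> 0" "\<not> ?f dvd 1"
    using d dvd_imp_degree_le[of ?f 1] by auto
  have g: "degree g = d - 1" "Polynomial.coeff g 0 = int d" "lead_coeff g = 1"
    "\<And>i. i < d - 1 \<Longrightarrow> int d dvd Polynomial.coeff g i"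
    using d dvd_choose_prime[OF _ _ _ assms]
    by (auto simp: g_def degree_pcompose deg coeff_geometric_poly_shift poly_sum poly_monom)
  have *: "v dvd 1" if uv: "?f = u * v"
    and nd: "\<not> int d dvd Polynomial.coeff (pcompose v [:1, 1:]) 0" for u v
  proof -
    let ?u = "pcompose u [:1, 1:]" and ?v = "pcompose v [:1, 1:]"
    have guv: "g = ?u * ?v" unfolding g_def uv pcompose_mult ..
    have "d - 1 \<le> degree ?u"
      using eisenstein_degree[of "int d" "d - 1" ?u ?v] g nd assms unfolding guv by auto
    moreover have "u \<noteq> 0" "v \<noteq> 0" using uv \<open>?f \<noteq> 0\<close> by auto
    hence "degree u + degree v = d - 1" using deg unfolding uv by (simp add: degree_mult_eq)
    ultimately have "degree v = 0" by (simp add: degree_pcompose)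
    then obtain c where c: "v = [:c:]" by (rule degree_eq_zeroE)
    have "lead_coeff ?v dvd 1" using g(3) unfolding guv by (metis dvd_triv_right lead_coeff_mult)
    thus "v dvd 1" unfolding c by (simp add: is_unit_const_poly_iff)
  qed
  show "u dvd 1 \<or> v dvd 1" if uv: "?f = u * v" for u v
  proof -
    let ?u = "pcompose u [:1, 1:]" and ?v = "pcompose v [:1, 1:]"
    have "Polynomial.coeff ?u 0 * Polynomial.coeff ?v 0 = int d"
      using g(2) unfolding g_def uv pcompose_mult by (simp add: coeff_mult)
    moreover have "\<not> int d * int d dvd int d" using d by auto
    ultimately have "\<not> int d dvd Polynomial.coeff ?u 0 \<or> \<not> int d dvd Polynomial.coeff ?v 0"
      by (metis mult_dvd_mono)
    moreover have "?f = v * u" unfolding uv by (rule mult.commute)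
    ultimately show ?thesis using *[OF uv] *[of v u] by blast
  qed
qed

section \<open>Bounded integer relations between powers\<close>

text \<open>Take a nonzero \<open>h\<close> of least degree in the ideal generated by
  \<open>c\<close> and \<open>f\<close>. Pseudo-division of \<open>f\<close> by \<open>h\<close> has
  remainder 0, so \<open>h * q = s * f\<close>. The prime \<open>f\<close> has larger degree than
  \<open>h\<close>, hence divides \<open>q\<close>; so \<open>h\<close> divides the constant
  \<open>s\<close>.\<close>

lemma const_in_ideal:
  fixes f c :: "'a :: idom poly"
  assumes "prime_elem f" "c \<noteq> 0" "degree c < degree f"
  obtains a b N where "N \<noteq> 0" "a * c + b * f = [:N:]"
proof -
  define P where "P = (\<lambda>h. h \<noteq> 0 \<and> (\<exists>a b. h = a * c + b * f))"
  have "P c" unfolding P_def using assms(2) by (intro conjI exI[of _ 1] exI[of _ 0]) auto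
  define h where "h = (ARG_MIN degree h. P h)"
  have h: "P h" "degree h \<le> degree c"
    unfolding h_def by (rule arg_min_natI[of P, OF \<open>P c\<close>], rule arg_min_nat_le[of P, OF \<open>P c\<close>])
  have min: "degree h \<le> degree r" if "P r" for r
    unfolding h_def by (rule arg_min_nat_le[of P, OF that])
  obtain a b where ab: "h = a * c + b * f" using h(1) by (auto simp: P_def)
  have "h \<noteq> 0" using h(1) by (simp add: P_def)
  have "degree h = 0"
  proof -
    define r where "r = pseudo_mod f h"
    obtain s q where sq: "s \<noteq> 0" "Polynomial.smult s f = h * q + r"
      and r: "r = 0 \<or> degree r < degree h"
      using pseudo_mod[OF \<open>h \<noteq> 0\<close>, of f] unfolding r_def by blast
    have "r = (- a * q) * c + ([:s:] - b * q) * f"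
      using sq(2) unfolding ab by (simp add: algebra_simps)
    hence "r = 0" using min[of r] r unfolding P_def by (metis not_less)
    with sq have hq: "h * q = f * [:s:]" by simp
    hence "f dvd h * q" by (simp add: dvd_smult)
    moreover have "\<not> f dvd h" using dvd_imp_degree_le[of f h] h(2) assms(3) \<open>h \<noteq> 0\<close> by auto
    ultimately have "f dvd q" using assms(1) prime_elem_dvd_multD by blast
    then obtain t where "q = f * t" by blast
    with hq have "f * (h * t) = f * [:s:]" by (simp add: mult_ac)
    hence "h * t = [:s:]" using assms(1) unfolding prime_elem_def mult_cancel_left by blast
    moreover from this have "t \<noteq> 0" using sq(1) by auto
    ultimately show ?thesis using \<open>h \<noteq> 0\<close> degree_mult_eq[of h t] by simp
  qed
  then obtain N where "h = [:N:]" by (rule degree_eq_zeroE)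
  thus ?thesis using that[of N a b] ab \<open>h \<noteq> 0\<close> by simp
qed

text \<open>Evaluating an ideal identity for a nonzero constant \<open>N c\<close> at
  \<open>g\<close> shows that a relation with nonzero \<open>c\<close> makes \<open>q\<close> divide
  \<open>N c\<close>. Only finitely many bounded \<open>c\<close> exist, so a large \<open>q\<close>
  excludes them all.\<close>

lemma powers_independent_mod:
  assumes "prime d"
  obtains Q :: nat where "\<And>q g c. q \<ge> Q \<Longrightarrow> int q dvd (\<Sum>k<d. g ^ k) \<Longrightarrow>
     (\<And>k. k < d - 1 \<Longrightarrow> \<bar>c k\<bar> \<le> int M) \<Longrightarrow> int q dvd (\<Sum>k<d - 1. c k * g ^ k) \<Longrightarrow>
     \<forall>k<d - 1. c k = 0"
proof -
  let ?f = "\<Sum>k<d. Polynomial.monom 1 k :: int poly"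
  let ?p = "\<lambda>c. \<Sum>k<d - 1. Polynomial.monom (c k) k :: int poly"
  have d: "d \<ge> 2" using assms prime_ge_2_nat by blast
  have prime: "prime_elem ?f"
    using irreducible_geometric_poly[OF assms] by (rule irreducible_imp_prime_elem)
  have deg: "degree (?p c) < degree ?f" for c
  proof -
    have "degree (?p c) \<le> d - 2"
      by (intro degree_sum_le order.trans[OF degree_monom_le]) auto
    thus ?thesis using d by (simp add: degree_geometric_poly)
  qed
  define N where "N = (\<lambda>c. SOME N. N \<noteq> 0 \<and> (\<exists>a b. a * ?p c + b * ?f = [:N:]))"
  have N: "N c \<noteq> 0 \<and> (\<exists>a b. a * ?p c + b * ?f = [:N c:])" if "?p c \<noteq> 0" for c
    unfolding N_def by (rule someI_ex, rule const_in_ideal[OF prime that deg]) blast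
  define F where "F = PiE {..<d - 1} (\<lambda>_. {- int M..int M})"
  have fin: "finite F" unfolding F_def by (intro finite_PiE) auto
  define Q where "Q = Suc (\<Sum>c\<in>F. nat \<bar>N c\<bar>)"
  show ?thesis
  proof (rule that[of Q], rule ccontr)
    fix q g and c :: "nat \<Rightarrow> int"
    assume q: "q \<ge> Q" "int q dvd (\<Sum>k<d. g ^ k)" "\<And>k. k < d - 1 \<Longrightarrow> \<bar>c k\<bar> \<le> int M"
      "int q dvd (\<Sum>k<d - 1. c k * g ^ k)" and "\<not> (\<forall>k<d - 1. c k = 0)"
    then obtain k where k: "k < d - 1" "c k \<noteq> 0" by blast
    \<comment> \<open>Only the first \<open>d - 1\<close> values of \<open>c\<close> matter; fixing
      the rest places it in the finite set \<open>F\<close>.\<close>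
    define c' where "c' = restrict c {..<d - 1}"
    have "c' \<in> F" unfolding F_def c'_def using q(3) by (auto simp: abs_le_iff minus_le_iff)
    have "Polynomial.coeff (?p c') k = c k" using k by (simp add: coeff_sum c'_def)
    hence "?p c' \<noteq> 0" using k(2) by auto
    then obtain a b where ab: "N c' \<noteq> 0" "a * ?p c' + b * ?f = [:N c':]" using N by blast
    have "poly (?p c') g = (\<Sum>k<d - 1. c k * g ^ k)"
      by (simp add: poly_sum poly_monom c'_def)
    moreover have "poly ?f g = (\<Sum>k<d. g ^ k)" by (simp add: poly_sum poly_monom)
    moreover have "poly a g * poly (?p c') g + poly b g * poly ?f g = N c'"
      using arg_cong[OF ab(2), of "\<lambda>p. poly p g"] by simp
    ultimately have "int q dvd N c'" using q(2,4) by (metis dvd_add dvd_mult)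
    hence "int q \<le> \<bar>N c'\<bar>" using dvd_imp_le_int[OF ab(1)] by force
    moreover have "nat \<bar>N c'\<bar> \<le> (\<Sum>c\<in>F. nat \<bar>N c\<bar>)"
      using \<open>c' \<in> F\<close> fin by (intro member_le_sum) auto
    ultimately show False using q(1) unfolding Q_def by linarith
  qed
qed

section \<open>Density of powers modulo \<open>q\<close>\<close>

lemma e_0 [simp]: "e 0 = 1"
  by (simp add: e_def)

lemma e_add: "e (x + y) = e x * e y"
  by (simp add: e_def distrib_left exp_add)

lemma norm_e [simp]: "cmod (e x) = 1"
  by (simp add: e_def)

lemma cnj_e: "cnj (e x) = e (- x)"
  by (simp add: e_def exp_cnj)

lemma e_power: "e x ^ n = e (of_nat n * x)"
  by (simp add: e_def mult_ac flip: exp_of_nat_mult)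

lemma e_sum: "e (\<Sum>k\<in>A. f k) = (\<Prod>k\<in>A. e (f k))"
  by (induction A rule: infinite_finite_induct) (auto simp: e_add)

lemma e_eq_1_iff: "e x = 1 \<longleftrightarrow> x \<in> \<int>"
proof -
  have "e x = 1 \<longleftrightarrow> (\<exists>n::int. 2 * pi * x = of_int (2 * n) * pi)"
    by (simp add: e_def exp_eq_1)
  also have "\<dots> \<longleftrightarrow> (\<exists>n::int. x = of_int n)" by auto
  finally show ?thesis by (auto simp: Ints_def)
qed

lemma e_frac_eq_1_iff:
  assumes "q > 0"
  shows "e (of_int m / of_nat q) = 1 \<longleftrightarrow> int q dvd m"
proof
  assume "e (of_int m / of_nat q) = 1"
  then obtain n :: int where "of_int m / of_nat q = (of_int n :: real)"
    unfolding e_eq_1_iff by (auto elim: Ints_cases)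
  hence "real_of_int m = of_int (n * int q)" using assms by (simp add: field_simps)
  hence "m = n * int q" unfolding of_int_eq_iff .
  thus "int q dvd m" by simp
next
  assume "int q dvd m"
  then obtain n where "m = int q * n" by blast
  thus "e (of_int m / of_nat q) = 1" using assms by (simp add: e_eq_1_iff)
qed

lemma e_frac_cong:
  assumes "q > 0" "[m = n] (mod int q)"
  shows "e (of_int m / of_nat q) = e (of_int n / of_nat q)"
proof -
  have "int q dvd m - n" using assms(2) by (simp add: cong_iff_dvd_diff)
  hence "e (of_int (m - n) / of_nat q) = 1" using e_frac_eq_1_iff[OF assms(1)] by blast
  moreover have "of_int m / of_nat q = of_int n / of_nat q + (of_int (m - n) / of_nat q :: real)"
    by (simp add: diff_divide_distrib)
  ultimately show ?thesis by (simp only: e_add mult_1_right)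
qed

lemma sum_e_frac_eq_0:
  assumes "q > 0" "\<not> int q dvd m"
  shows "(\<Sum>a<q. e (of_int (int a * m) / of_nat q)) = 0"
proof -
  let ?w = "e (of_int m / of_nat q)"
  have "(\<Sum>a<q. e (of_int (int a * m) / of_nat q)) = (\<Sum>a<q. ?w ^ a)"
    by (simp add: e_power)
  also have "?w ^ q = 1" using assms(1) by (simp add: e_power e_eq_1_iff)
  hence "(\<Sum>a<q. ?w ^ a) = 0"
    using e_frac_eq_1_iff[OF assms(1)] assms(2) by (simp add: sum_gp_strict)
  finally show ?thesis .
qed

text \<open>The frequencies \<open>m j\<close> are distinct modulo \<open>q\<close>, so the cross
  terms of the expanded square are full character sums and vanish.\<close>

lemma parseval_frac:
  fixes W :: "'i \<Rightarrow> real" and \<omega> :: "'i \<Rightarrow> complex" and m :: "'i \<Rightarrow> int"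
  assumes "q > 0" "finite J" "\<And>j. j \<in> J \<Longrightarrow> cmod (\<omega> j) = 1"
    and inj: "\<And>i j. i \<in> J \<Longrightarrow> j \<in> J \<Longrightarrow> int q dvd m i - m j \<Longrightarrow> i = j"
  shows "(\<Sum>a<q. (cmod (\<Sum>j\<in>J. W j * \<omega> j * e (of_int (int a * m j) / of_nat q)))\<^sup>2)
           = q * (\<Sum>j\<in>J. (W j)\<^sup>2)" (is "?L = _")
proof -
  let ?E = "\<lambda>a j. e (of_int (int a * m j) / of_nat q)"
  let ?c = "\<lambda>i j. W i * \<omega> i * (W j * cnj (\<omega> j))"
  have *: "(\<Sum>a<q. ?E a i * cnj (?E a j)) = (if i = j then of_nat q else 0)"
    if "i \<in> J" "j \<in> J" for i j
  proof -
    have "?E a i * cnj (?E a j) = e (of_int (int a * (m i - m j)) / of_nat q)" for a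
      unfolding cnj_e e_add[symmetric] by (simp add: field_simps diff_divide_distrib)
    thus ?thesis
      using sum_e_frac_eq_0[OF assms(1), of "m i - m j"] inj[OF that] by auto
  qed
  have "of_real ?L = (\<Sum>a<q. (\<Sum>i\<in>J. W i * \<omega> i * ?E a i) * cnj (\<Sum>j\<in>J. W j * \<omega> j * ?E a j))"
    unfolding of_real_sum complex_norm_square ..
  also have "\<dots> = (\<Sum>a<q. \<Sum>i\<in>J. \<Sum>j\<in>J. ?c i j * (?E a i * cnj (?E a j)))"
    unfolding cnj_sum sum_product by (simp add: mult_ac)
  also have "\<dots> = (\<Sum>i\<in>J. \<Sum>j\<in>J. ?c i j * (\<Sum>a<q. ?E a i * cnj (?E a j)))"
    unfolding sum_distrib_left
    by (subst sum.swap, rule sum.cong[OF refl], rule sum.swap)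
  also have "\<dots> = (\<Sum>i\<in>J. \<Sum>j\<in>J. ?c i j * (if i = j then of_nat q else 0))"
    by (intro sum.cong refl, simp only: *)
  also have "\<dots> = (\<Sum>i\<in>J. ?c i i * of_nat q)"
    using assms(2) by (simp add: if_distrib[of "\<lambda>x. _ * x"] cong: if_cong)
  also have "\<dots> = (\<Sum>i\<in>J. of_real (q * (W i)\<^sup>2))"
  proof (intro sum.cong refl)
    fix i assume "i \<in> J"
    have "?c i i = of_real ((W i)\<^sup>2) * (\<omega> i * cnj (\<omega> i))" by (simp add: power2_eq_square mult_ac)
    also have "\<omega> i * cnj (\<omega> i) = 1"
      using assms(3)[OF \<open>i \<in> J\<close>] by (simp flip: complex_norm_square)
    finally show "?c i i * of_nat q = of_real (q * (W i)\<^sup>2)" by (simp add: mult_ac)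
  qed
  finally have "of_real ?L = (of_real (q * (\<Sum>j\<in>J. (W j)\<^sup>2)) :: complex)"
    by (simp add: sum_distrib_left)
  thus ?thesis unfolding of_real_eq_iff .
qed

section \<open>Simultaneous approximation by a second moment\<close>

lemma exists_large_product:
  fixes g :: int and \<omega> :: "nat \<Rightarrow> complex"
  assumes "q > 0" and unit: "\<And>k. k < n \<Longrightarrow> cmod (\<omega> k) = 1"
    and indep: "\<And>c. (\<And>k. k < n \<Longrightarrow> \<bar>c k\<bar> \<le> int M) \<Longrightarrow> int q dvd (\<Sum>k<n. c k * g ^ k)
                  \<Longrightarrow> \<forall>k<n. c k = 0"
  shows "\<exists>a<q. (\<Prod>k<n. ((cmod (1 + \<omega> k * e (of_int (int a * g ^ k) / of_nat q)))\<^sup>2 / 4) ^ M)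
       \<ge> 1 / (real M + 1) ^ n"
proof -
  \<comment> \<open>\<open>J\<close> indexes the monomials in the expansion of \<open>P\<close>:
    \<open>W\<close> is the binomial weight, \<open>\<Omega>\<close> the unit coefficient and
    \<open>m\<close> the frequency in \<open>a\<close>.\<close>
  define J where "J = PiE {..<n} (\<lambda>_. {..M})"
  define W where "W = (\<lambda>j. \<Prod>k<n. real (M choose (j k)))"
  define \<Omega> where "\<Omega> = (\<lambda>j. \<Prod>k<n. \<omega> k ^ (j k :: nat))"
  define m where "m = (\<lambda>j. \<Sum>k<n. int (j k) * g ^ k)"
  define z where "z = (\<lambda>a k. \<omega> k * e (of_int (int a * g ^ k) / of_nat q))"
  define P where "P = (\<lambda>a. \<Prod>k<n. (1 + z a k) ^ M)"
  have fin: "finite J" unfolding J_def by (intro finite_PiE) auto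
  have P: "P a = (\<Sum>j\<in>J. W j * \<Omega> j * e (of_int (int a * m j) / of_nat q))" for a
  proof -
    have "P a = (\<Prod>k<n. \<Sum>i\<le>M. of_nat (M choose i) * z a k ^ i)"
      unfolding P_def by (simp add: binomial_ring add.commute[of 1])
    also have "\<dots> = (\<Sum>j\<in>J. \<Prod>k<n. of_nat (M choose (j k)) * z a k ^ (j k))"
      unfolding J_def by (intro prod_sum_PiE) auto
    also have "\<dots> = (\<Sum>j\<in>J. W j * \<Omega> j * e (of_int (int a * m j) / of_nat q))"
    proof (intro sum.cong refl)
      fix j
      have "of_int (int a * m j) / of_nat q
              = (\<Sum>k<n. real (j k) * (of_int (int a * g ^ k) / of_nat q))"
        by (simp add: m_def sum_distrib_left sum_divide_distrib mult_ac)
      hence "e (of_int (int a * m j) / of_nat q)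
               = (\<Prod>k<n. e (of_int (int a * g ^ k) / of_nat q) ^ j k)"
        by (simp add: e_sum e_power)
      thus "(\<Prod>k<n. of_nat (M choose (j k)) * z a k ^ (j k))
              = W j * \<Omega> j * e (of_int (int a * m j) / of_nat q)"
        by (simp add: W_def \<Omega>_def z_def prod.distrib power_mult_distrib mult_ac)
    qed
    finally show ?thesis .
  qed
  have parseval: "(\<Sum>a<q. (cmod (P a))\<^sup>2) = q * (\<Sum>j\<in>J. (W j)\<^sup>2)"
    unfolding P
  proof (rule parseval_frac[OF assms(1) fin])
    show "cmod (\<Omega> j) = 1" if "j \<in> J" for j
      unfolding \<Omega>_def prod_norm[symmetric] using unit by (simp add: norm_power)
    fix i j assume ij: "i \<in> J" "j \<in> J" "int q dvd m i - m j"
    \<comment> \<open>Exponents lie between 0 and \<open>M\<close>, so their differences obey the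
      bound required by \<open>indep\<close>.\<close>
    have "\<forall>k<n. int (i k) - int (j k) = 0"
    proof (rule indep)
      show "\<bar>int (i k) - int (j k)\<bar> \<le> int M" if "k < n" for k
      proof -
        have "i k \<le> M" "j k \<le> M" using ij(1,2) that by (auto simp: J_def)
        thus ?thesis by linarith
      qed
      show "int q dvd (\<Sum>k<n. (int (i k) - int (j k)) * g ^ k)"
        using ij(3) by (simp add: m_def left_diff_distrib sum_subtractf)
    qed
    thus "i = j"
      using ij(1,2) unfolding J_def by (intro PiE_ext[of i "{..<n}" _ j]) auto
  qed
  have sumW: "(\<Sum>j\<in>J. W j) = (2 ^ M) ^ n"
  proof -
    have "(\<Prod>k<n. \<Sum>i\<le>M. real (M choose i)) = (\<Sum>j\<in>J. W j)"
      unfolding J_def W_def by (intro prod_sum_PiE) auto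
    moreover have "(\<Sum>i\<le>M. real (M choose i)) = 2 ^ M"
      using choose_row_sum[of M] by (metis of_nat_numeral of_nat_power of_nat_sum)
    ultimately show ?thesis by simp
  qed
  have "real (card J) = (real M + 1) ^ n"
    unfolding J_def by (simp add: card_PiE add.commute)
  moreover have "((2 ^ M) ^ n)\<^sup>2 = ((2::real)\<^sup>2) ^ (M * n)"
    by (simp only: mult_ac flip: power_mult)
  \<comment> \<open>Cauchy-Schwarz: the squared sum of the weights is at most \<open>card J\<close>
    times the sum of their squares.\<close>
  ultimately have CS: "4 ^ (M * n) / (real M + 1) ^ n \<le> (\<Sum>j\<in>J. (W j)\<^sup>2)"
    using sum_squared_le_sum_of_squares[of W J] unfolding sumW by (simp add: divide_le_eq)
  have "\<exists>a<q. (\<Sum>j\<in>J. (W j)\<^sup>2) \<le> (cmod (P a))\<^sup>2"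
  proof (rule ccontr)
    assume "\<not> ?thesis"
    hence "(\<Sum>a<q. (cmod (P a))\<^sup>2) < (\<Sum>a<q. (\<Sum>j\<in>J. (W j)\<^sup>2))"
      using assms(1) by (intro sum_strict_mono) (auto simp: not_le lessThan_empty_iff)
    thus False using parseval by simp
  qed
  then obtain a where a: "a < q" "4 ^ (M * n) / (real M + 1) ^ n \<le> (cmod (P a))\<^sup>2"
    using CS order.trans by blast
  have "(cmod (P a))\<^sup>2 = (\<Prod>k<n. ((cmod (1 + z a k))\<^sup>2) ^ M)"
    unfolding P_def prod_norm[symmetric] norm_power prod_power_distrib[symmetric]
    by (simp add: power_mult[symmetric] mult.commute)
  also have "\<dots> = (\<Prod>k<n. 4 ^ M * ((cmod (1 + z a k))\<^sup>2 / 4) ^ M)"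
    by (simp add: power_divide)
  also have "\<dots> = 4 ^ (M * n) * (\<Prod>k<n. ((cmod (1 + z a k))\<^sup>2 / 4) ^ M)"
    by (simp add: prod.distrib power_mult)
  finally have "4 ^ (M * n) * (1 / (real M + 1) ^ n)
      \<le> 4 ^ (M * n) * (\<Prod>k<n. ((cmod (1 + z a k))\<^sup>2 / 4) ^ M)"
    using a(2) by simp
  hence "1 / (real M + 1) ^ n \<le> (\<Prod>k<n. ((cmod (1 + z a k))\<^sup>2 / 4) ^ M)"
    by (rule mult_left_le_imp_le) simp
  thus ?thesis using a(1) unfolding z_def by blast
qed

text \<open>Taking \<open>n\<close>-th roots reduces this to
  \<open>(real M + 1) * x ^ M < 1\<close>, whose left side tends to 0. The case
  \<open>n = 0\<close>, where no such root is available, is separate.\<close>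

lemma exponential_beats_polynomial:
  fixes r :: real
  assumes "0 \<le> r" "r < 1"
  obtains M where "r ^ M < 1 / (real M + 1) ^ n"
proof (cases "n = 0")
  case True
  thus ?thesis using assms(2) by (intro that[of 1]) auto
next
  case False
  define x where "x = root n r"
  have x: "0 \<le> x" "x < 1" "x ^ n = r"
    using assms False by (auto simp: x_def)
  have "(\<lambda>M. real M * x ^ M + x ^ M) \<longlonglongrightarrow> 0 + 0"
    using x by (intro tendsto_add powser_times_n_limit_0 LIMSEQ_power_zero) auto
  hence "eventually (\<lambda>M. real M * x ^ M + x ^ M < 1) sequentially"
    by (intro order_tendstoD(2)) auto
  then obtain M where "real M * x ^ M + x ^ M < 1" by (auto simp: eventually_sequentially)
  hence "(real M + 1) * x ^ M < 1" by (simp add: algebra_simps)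
  hence "((real M + 1) * x ^ M) ^ n < 1 ^ n"
    using x False by (intro power_strict_mono) auto
  hence "(real M + 1) ^ n * r ^ M < 1"
    by (simp add: power_mult_distrib power_mult[symmetric] mult.commute flip: x(3))
  thus ?thesis by (intro that[of M]) (simp add: field_simps)
qed

lemma norm_one_minus_unit:
  assumes "cmod z = 1"
  shows "(cmod (z - 1))\<^sup>2 = 4 - (cmod (1 + z))\<^sup>2"
proof -
  have "(Re z)\<^sup>2 + (Im z)\<^sup>2 = 1" using assms by (metis cmod_power2 one_power2)
  thus ?thesis unfolding cmod_power2 by (simp add: power2_eq_square algebra_simps)
qed

text \<open>All factors \<open>(cmod (1 + z a k))\<^sup>2 / 4\<close> are at most 1, so a product of
  their \<open>M\<close>-th powers exceeding \<open>r ^ M\<close> forces each of them above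
  \<open>r\<close>, which puts \<open>z a k\<close> near 1.\<close>

lemma powers_dense_mod:
  assumes "prime d" "\<eta> > 0"
  obtains Q :: nat where "\<And>q g \<omega>. q \<ge> Q \<Longrightarrow> q > 0 \<Longrightarrow> int q dvd (\<Sum>k<d. g ^ k) \<Longrightarrow>
     (\<And>k. k < d - 1 \<Longrightarrow> cmod (\<omega> k) = 1) \<Longrightarrow>
     \<exists>a<q. \<forall>k<d - 1. cmod (\<omega> k * e (of_int (int a * g ^ k) / of_nat q) - 1) < \<eta>"
proof -
  define n where "n = d - 1"
  \<comment> \<open>A factor above \<open>r\<close> gives squared distance to 1 below
    \<open>4 - 4 * r\<close>, hence below \<open>\<eta>\<^sup>2\<close>; the minimum keeps
    \<open>r\<close> nonnegative.\<close>
  define r where "r = 1 - min 1 (\<eta>\<^sup>2 / 4)"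
  have r: "0 \<le> r" "r < 1" "4 - 4 * r \<le> \<eta>\<^sup>2" using assms(2) by (auto simp: r_def min_def)
  obtain M where M: "r ^ M < 1 / (real M + 1) ^ n"
    using exponential_beats_polynomial[OF r(1,2)] by blast
  obtain Q :: nat where Q: "\<And>q g c. q \<ge> Q \<Longrightarrow> int q dvd (\<Sum>k<d. g ^ k) \<Longrightarrow>
     (\<And>k. k < n \<Longrightarrow> \<bar>c k\<bar> \<le> int M) \<Longrightarrow> int q dvd (\<Sum>k<n. c k * g ^ k) \<Longrightarrow> \<forall>k<n. c k = 0"
    using powers_independent_mod[OF assms(1)] unfolding n_def by blast
  show ?thesis
  proof (rule that[of Q], unfold n_def[symmetric])
    fix q :: nat and g :: int and \<omega> :: "nat \<Rightarrow> complex"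
    assume q: "q \<ge> Q" "q > 0" "int q dvd (\<Sum>k<d. g ^ k)" and \<omega>: "\<And>k. k < n \<Longrightarrow> cmod (\<omega> k) = 1"
    define z where "z = (\<lambda>a k. \<omega> k * e (of_int (int a * g ^ k) / of_nat q))"
    have norm_z: "cmod (z a k) = 1" if "k < n" for a k
      using \<omega>[OF that] by (simp add: z_def norm_mult)
    have "\<exists>a<q. (\<Prod>k<n. ((cmod (1 + z a k))\<^sup>2 / 4) ^ M) \<ge> 1 / (real M + 1) ^ n"
      unfolding z_def by (intro exists_large_product q(2) \<omega> Q[OF q(1,3)])
    then obtain a where a: "a < q"
      "(\<Prod>k<n. ((cmod (1 + z a k))\<^sup>2 / 4) ^ M) \<ge> 1 / (real M + 1) ^ n"
      by blast
    have "cmod (z a k - 1) < \<eta>" if k: "k < n" for k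
    proof -
      let ?r = "\<lambda>k. (cmod (1 + z a k))\<^sup>2 / 4"
      have le1: "?r j \<le> 1" if "j < n" for j
      proof -
        have "cmod (1 + z a j) \<le> 2" using norm_triangle_ineq[of 1 "z a j"] norm_z[OF that] by simp
        hence "(cmod (1 + z a j))\<^sup>2 \<le> 2\<^sup>2" by (intro power_mono) auto
        thus ?thesis by simp
      qed
      have "(\<Prod>j<n. ?r j ^ M) = ?r k ^ M * (\<Prod>j\<in>{..<n} - {k}. ?r j ^ M)"
        using k by (simp add: prod.remove[of "{..<n}" k])
      also have "(\<Prod>j\<in>{..<n} - {k}. ?r j ^ M) \<le> 1"
        by (intro prod_le_1 conjI power_le_one le1) auto
      hence "?r k ^ M * (\<Prod>j\<in>{..<n} - {k}. ?r j ^ M) \<le> ?r k ^ M"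
        by (intro mult_left_le) auto
      finally have "r ^ M < ?r k ^ M" using a(2) M by linarith
      hence "r < ?r k" by (rule power_less_imp_less_base) simp
      hence "(cmod (z a k - 1))\<^sup>2 < \<eta>\<^sup>2"
        using r(3) unfolding norm_one_minus_unit[OF norm_z[OF k]] by simp
      thus ?thesis by (rule power2_less_imp_less) (use assms(2) in simp)
    qed
    with a(1) show "\<exists>a<q. \<forall>k<n. cmod (\<omega> k * e (of_int (int a * g ^ k) / of_nat q) - 1) < \<eta>"
      unfolding z_def by blast
  qed
qed

section \<open>Kloosterman sums\<close>

text \<open>With \<open>t = totient q div d\<close>, both claims compare exponents of
  \<open>g\<close> modulo \<open>t * d\<close>: \<open>h ^ i\<close> is 1 iff \<open>d\<close>
  divides \<open>i\<close>, and \<open>u = g ^ i\<close> with \<open>u ^ d = 1\<close> forces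
  \<open>t\<close> to divide \<open>i\<close>.\<close>

lemma bij_betw_roots_of_unity_mod:
  assumes "q > 1" "residue_primroot q g" "d > 0" "d dvd totient q"
  defines "h \<equiv> g ^ (totient q div d)"
  shows "ord q h = d"
    and "bij_betw (\<lambda>k. h ^ k mod q) {..<d} {u \<in> totatives q. [u ^ d = 1] (mod q)}"
proof -
  define t where "t = totient q div d"
  have t: "totient q = t * d" using assms(4) by (simp add: t_def)
  moreover have "totient q > 0" using assms(1) by simp
  ultimately have "t > 0" by (cases t) auto
  have g: "coprime q g" "ord q g = totient q"
    using assms(2) by (auto simp: residue_primroot_def)
  have cop: "coprime q h" using g(1) by (simp add: h_def)
  have h1: "[h ^ i = 1] (mod q) \<longleftrightarrow> d dvd i" for i
  proof -
    have "[h ^ i = 1] (mod q) \<longleftrightarrow> [g ^ (t * i) = 1] (mod q)"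
      unfolding h_def t_def power_mult ..
    also have "\<dots> \<longleftrightarrow> t * d dvd t * i" unfolding ord_divides g(2) t ..
    also have "\<dots> \<longleftrightarrow> d dvd i" using \<open>t > 0\<close> by simp
    finally show ?thesis .
  qed
  show ord: "ord q h = d"
    using h1 unfolding ord_divides by (metis dvd_antisym dvd_refl)
  show "bij_betw (\<lambda>k. h ^ k mod q) {..<d} {u \<in> totatives q. [u ^ d = 1] (mod q)}"
    unfolding bij_betw_def
  proof (intro conjI equalityI subsetI)
    show "inj_on (\<lambda>k. h ^ k mod q) {..<d}"
      using inj_power_mod[OF cop] by (simp add: ord)
  next
    fix u assume "u \<in> (\<lambda>k. h ^ k mod q) ` {..<d}"
    then obtain k where k: "u = h ^ k mod q" by blast
    have "[u ^ d = (h ^ k) ^ d] (mod q)" unfolding k by (intro cong_pow) simp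
    also have "[(h ^ k) ^ d = 1] (mod q)" using h1[of "k * d"] by (simp add: power_mult)
    finally show "u \<in> {u \<in> totatives q. [u ^ d = 1] (mod q)}"
      using power_in_totatives[OF assms(1) cop] k by simp
  next
    fix u assume u: "u \<in> {u \<in> totatives q. [u ^ d = 1] (mod q)}"
    then obtain i where i: "u = g ^ i mod q"
      using residue_primroot_is_generator[OF assms(1,2)] unfolding bij_betw_def by blast
    have "[(g ^ i) ^ d = u ^ d] (mod q)" unfolding i by (intro cong_pow) simp
    also have "[u ^ d = 1] (mod q)" using u by simp
    finally have "[g ^ (i * d) = 1] (mod q)" by (simp add: power_mult)
    hence "t * d dvd i * d" unfolding ord_divides g(2) t .
    hence "t dvd i" using assms(3) by simp
    then obtain j where j: "i = t * j" by blast
    have "u = h ^ j mod q" by (simp add: i j h_def t_def power_mult)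
    also have "[h ^ j = h ^ (j mod d)] (mod q)"
      unfolding order_divides_expdiff[OF cop] ord by simp
    hence "h ^ j mod q = h ^ (j mod d) mod q" by (simp add: cong_def)
    finally show "u \<in> (\<lambda>k. h ^ k mod q) ` {..<d}" using assms(3) by simp
  qed
qed

text \<open>Since \<open>h ^ d = 1\<close>, the inverse of \<open>h ^ k\<close> is
  \<open>h ^ (d - k)\<close>, which keeps all exponents natural.\<close>

lemma kloosterman_eq_sum_powers:
  assumes "q > 1" "ord q h = d" "d > 0"
    and bij: "bij_betw (\<lambda>k. h ^ k mod q) {..<d} {u \<in> totatives q. [u ^ d = 1] (mod q)}"
  shows "kloosterman a b q d = (\<Sum>k<d. e (of_int (a * int h ^ k + b * int h ^ (d - k)) / of_nat q))"
proof -
  have hd: "[h ^ d = 1] (mod q)" unfolding ord_divides assms(2) by simp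
  let ?inv = "\<lambda>k. modular_inverse (int q) (int (h ^ k mod q))"
  have "kloosterman a b q d
      = (\<Sum>k<d. e (of_int (a * int (h ^ k mod q) + b * ?inv k) / of_nat q))"
    unfolding kloosterman_def by (rule sum.reindex_bij_betw[OF bij, symmetric])
  also have "\<dots> = (\<Sum>k<d. e (of_int (a * int h ^ k + b * int h ^ (d - k)) / of_nat q))"
  proof (intro sum.cong refl e_frac_cong)
    show "q > 0" using assms(1) by simp
    fix k assume "k \<in> {..<d}"
    have u: "[int (h ^ k mod q) = int h ^ k] (mod int q)"
      by (simp add: cong_def zmod_int)
    have "h ^ k mod q \<in> totatives q"
      using bij \<open>k \<in> {..<d}\<close> unfolding bij_betw_def by blast
    hence "coprime (int (h ^ k mod q)) (int q)" by (simp add: totatives_def coprime_commute)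
    hence inv: "[?inv k * int (h ^ k mod q) = 1] (mod int q)"
      by (rule cong_modular_inverse2)
    have "h ^ k * h ^ (d - k) = h ^ d"
      using \<open>k \<in> {..<d}\<close> by (simp flip: power_add)
    hence 1: "[int h ^ k * int h ^ (d - k) = 1] (mod int q)"
      using hd by (metis cong_int_iff of_nat_1 of_nat_mult of_nat_power)
    have "[?inv k * 1 = ?inv k * (int h ^ k * int h ^ (d - k))] (mod int q)"
      using 1 by (intro cong_mult cong_refl) (rule cong_sym)
    also have "[?inv k * (int h ^ k * int h ^ (d - k))
        = ?inv k * (int (h ^ k mod q) * int h ^ (d - k))] (mod int q)"
      by (intro cong_mult cong_refl cong_sym[OF u])
    also have "?inv k * (int (h ^ k mod q) * int h ^ (d - k))
        = (?inv k * int (h ^ k mod q)) * int h ^ (d - k)"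
      by (simp only: mult.assoc)
    also have "[\<dots> = 1 * int h ^ (d - k)] (mod int q)"
      by (intro cong_mult cong_refl inv)
    finally show "[a * int (h ^ k mod q) + b * ?inv k = a * int h ^ k + b * int h ^ (d - k)] (mod int q)"
      using u by (intro cong_add cong_mult cong_refl) simp_all
  qed
  finally show ?thesis .
qed

text \<open>Factor \<open>g ^ d - 1\<close> as \<open>g - 1\<close> times the sum. If
  \<open>p\<close> divided \<open>g - 1\<close>, the sum would be \<open>d\<close> modulo
  \<open>p\<close>, hence a unit, and \<open>p ^ \<alpha>\<close> would divide \<open>g - 1\<close>.
  So \<open>g - 1\<close> is coprime to \<open>p\<close>.\<close>

lemma prime_power_dvd_geometric_sum:
  fixes g :: int
  assumes "prime p" "\<not> p dvd d" "int p ^ \<alpha> dvd g ^ d - 1" "\<not> int p ^ \<alpha> dvd g - 1"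
  shows "int p ^ \<alpha> dvd (\<Sum>k<d. g ^ k)"
proof -
  let ?s = "\<Sum>k<d. g ^ k"
  have p: "prime (int p)" using assms(1) by simp
  have eq: "g ^ d - 1 = (g - 1) * ?s" by (rule power_diff_1_eq)
  have "\<not> int p dvd g - 1"
  proof
    assume "int p dvd g - 1"
    hence "[g = 1] (mod int p)" by (simp add: cong_iff_dvd_diff)
    hence "[?s = (\<Sum>k<d. 1 ^ k)] (mod int p)" by (intro cong_sum cong_pow)
    hence "[?s = int d] (mod int p)" by simp
    hence "\<not> int p dvd ?s" using assms(2) by (metis cong_dvd_iff int_dvd_int_iff)
    hence "coprime (int p ^ \<alpha>) ?s" using p by (simp add: prime_imp_coprime)
    thus False using assms(3,4) unfolding eq by (simp add: coprime_dvd_mult_left_iff)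
  qed
  hence "coprime (int p ^ \<alpha>) (g - 1)" using p by (simp add: prime_imp_coprime)
  thus ?thesis using assms(3) unfolding eq by (simp add: coprime_dvd_mult_right_iff)
qed

lemma kloosterman_prime_power:
  assumes "prime d" "prime p" "\<alpha> \<ge> 1" "q = p ^ \<alpha>" "odd q" "[p = 1] (mod d)"
  obtains g :: int where "int q dvd (\<Sum>k<d. g ^ k)"
    "\<And>a b. kloosterman a b q d = (\<Sum>k<d. e (of_int (a * g ^ k + b * g ^ (d - k)) / of_nat q))"
proof -
  have d: "d > 1" using assms(1) prime_gt_1_nat by blast
  have p: "p > 1" "odd p" using assms prime_gt_1_nat by auto
  have q: "q > 1" unfolding assms(4) by (rule one_less_power) (use p assms(3) in auto)
  have dp: "d dvd p - 1" by (rule cong_to_1_nat[OF assms(6)])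
  hence "d < p" using p(1) by (auto dest!: dvd_imp_le)
  have dt: "d dvd totient q"
    unfolding assms(4) using dp assms(2,3) by (simp add: totient_prime_power)
  obtain g where "\<forall>k>0. residue_primroot (p ^ k) g"
    using residue_primroot_odd_prime_power_exists[OF assms(2) p(2)] .
  hence g: "residue_primroot q g" using assms(3,4) by simp
  define h where "h = g ^ (totient q div d)"
  have h: "ord q h = d" "bij_betw (\<lambda>k. h ^ k mod q) {..<d} {u \<in> totatives q. [u ^ d = 1] (mod q)}"
    using bij_betw_roots_of_unity_mod[OF q g _ dt] d unfolding h_def by auto
  have "[h ^ d = 1] (mod q)" "\<not> [h ^ 1 = 1] (mod q)" unfolding ord_divides h(1) using d by auto
  hence "int q dvd int h ^ d - 1" "\<not> int q dvd int h - 1"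
    by (metis cong_iff_dvd_diff cong_int_iff of_nat_1 of_nat_power power_one_right)+
  \<comment> \<open>The congruence of \<open>p\<close> to 1 enters twice: it makes \<open>d\<close>
    divide the totient, and it gives \<open>d < p\<close>.\<close>
  moreover have "\<not> p dvd d" using \<open>d < p\<close> d by (auto dest: dvd_imp_le)
  ultimately have "int q dvd (\<Sum>k<d. int h ^ k)"
    using prime_power_dvd_geometric_sum[OF assms(2), of d \<alpha> "int h"] by (simp add: assms(4))
  thus ?thesis
    using that[of "int h"] kloosterman_eq_sum_powers[OF q h(1) _ h(2)] d by auto
qed

section \<open>Containment and density of the sums\<close>

text \<open>Reversing the order of the \<open>b\<close> terms exhibits the total as
  \<open>a + b * g\<close> times the geometric sum. Hence the terms of a Kloosterman sum have
  product 1.\<close>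

lemma sum_powers_dvd:
  fixes g :: int
  assumes "q dvd (\<Sum>k<d. g ^ k)"
  shows "q dvd (\<Sum>k<d. a * g ^ k + b * g ^ (d - k))"
proof -
  have "(\<Sum>k<d. g ^ (d - k)) = (\<Sum>k<d. g * g ^ (d - Suc k))"
    by (intro sum.cong refl) (simp add: Suc_diff_Suc flip: power_Suc)
  also have "\<dots> = g * (\<Sum>k<d. g ^ k)"
    by (simp add: sum.nat_diff_reindex flip: sum_distrib_left)
  finally have "(\<Sum>k<d. a * g ^ k + b * g ^ (d - k)) = (a + b * g) * (\<Sum>k<d. g ^ k)"
    by (simp add: sum.distrib ring_distribs mult.assoc flip: sum_distrib_left)
  thus ?thesis using assms by simp
qed

lemma prod_e_eq_1:
  assumes "q > 0" "int q dvd (\<Sum>k<d. m k)"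
  shows "(\<Prod>k<d. e (of_int (m k) / of_nat q)) = 1"
proof -
  have "(\<Prod>k<d. e (of_int (m k) / of_nat q)) = e (of_int (\<Sum>k<d. m k) / of_nat q)"
    by (simp add: sum_divide_distrib flip: e_sum)
  thus ?thesis using iffD2[OF e_frac_eq_1_iff[OF assms(1)] assms(2)] by (rule trans)
qed

text \<open>Closeness is assumed for \<open>n\<close> summands only. The last is the conjugate of
  the product of the others, and products of unit numbers differ by at most the sum of the
  differences, so it adds a further \<open>n * \<eta>\<close>.\<close>

lemma dist_unit_sums_le:
  fixes y z :: "nat \<Rightarrow> complex"
  assumes "\<And>k. k \<le> n \<Longrightarrow> cmod (y k) = 1" "\<And>k. k \<le> n \<Longrightarrow> cmod (z k) = 1"
    and "(\<Prod>k<Suc n. y k) = 1" "(\<Prod>k<Suc n. z k) = 1"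
    and close: "\<And>k. k < n \<Longrightarrow> cmod (y k - z k) \<le> \<eta>"
  shows "cmod ((\<Sum>k<Suc n. y k) - (\<Sum>k<Suc n. z k)) \<le> 2 * real n * \<eta>"
proof -
  have last: "x n = cnj (\<Prod>k<n. x k)"
    if "\<And>k. k \<le> n \<Longrightarrow> cmod (x k) = 1" "(\<Prod>k<Suc n. x k) = 1" for x :: "nat \<Rightarrow> complex"
  proof -
    have "cmod (\<Prod>k<n. x k) = 1" unfolding prod_norm[symmetric] using that(1) by simp
    hence "(\<Prod>k<n. x k) * cnj (\<Prod>k<n. x k) = 1"
      unfolding complex_norm_square[symmetric] by simp
    thus ?thesis using that(2) by (metis inverse_unique mult.commute prod.lessThan_Suc)
  qed
  have sum: "(\<Sum>k<n. cmod (y k - z k)) \<le> real n * \<eta>"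
    using sum_mono[of "{..<n}" "\<lambda>k. cmod (y k - z k)" "\<lambda>_. \<eta>"] close by simp
  have "y n = cnj (\<Prod>k<n. y k)" "z n = cnj (\<Prod>k<n. z k)"
    by (rule last, rule assms, assumption, rule assms)+
  hence "cmod (y n - z n) = cmod (cnj ((\<Prod>k<n. y k) - (\<Prod>k<n. z k)))"
    by (simp only: complex_cnj_diff)
  also have "\<dots> = cmod ((\<Prod>k<n. y k) - (\<Prod>k<n. z k))" by (rule complex_mod_cnj)
  also have "\<dots> \<le> (\<Sum>k<n. cmod (y k - z k))"
    by (intro norm_prod_diff) (simp_all add: assms(1,2))
  finally have "cmod (y n - z n) \<le> real n * \<eta>" using sum by linarith
  moreover have "cmod ((\<Sum>k<Suc n. y k) - (\<Sum>k<Suc n. z k))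
      \<le> (\<Sum>k<Suc n. cmod (y k - z k))"
    unfolding sum_subtractf[symmetric] by (rule norm_sum)
  ultimately show ?thesis using sum by simp
qed

lemma kloosterman_dense_unit_sums:
  assumes "prime d" "\<epsilon> > 0" "w \<in> unit_sums d"
  shows "\<exists>Q::nat. \<forall>(q::nat) (p::nat) (\<alpha>::nat).
    prime p \<and> \<alpha> \<ge> 1 \<and> q = p ^ \<alpha> \<and> odd q \<and> [p = 1] (mod d) \<and> q \<ge> Q \<longrightarrow>
      (\<exists>a\<in>{0..<int q}. kloosterman a b q d \<in> ball w \<epsilon>)"
proof -
  have d: "d > 1" using assms(1) prime_gt_1_nat by blast
  then obtain n where n: "d = Suc n" using not0_implies_Suc by fastforce
  obtain y where y: "w = (\<Sum>k<d. y k)" "\<And>k. k < d \<Longrightarrow> cmod (y k) = 1" "(\<Prod>k<d. y k) = 1"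
    using assms(3) unfolding unit_sums_def by blast
  define \<eta> where "\<eta> = \<epsilon> / (2 * real d)"
  have \<eta>: "\<eta> > 0" using assms(2) d by (simp add: \<eta>_def)
  have \<eta>': "2 * real n * \<eta> < \<epsilon>" using assms(2) by (simp add: \<eta>_def n field_simps)
  obtain Q :: nat where Q: "\<And>q g \<omega>. q \<ge> Q \<Longrightarrow> q > 0 \<Longrightarrow> int q dvd (\<Sum>k<d. g ^ k) \<Longrightarrow>
     (\<And>k. k < d - 1 \<Longrightarrow> cmod (\<omega> k) = 1) \<Longrightarrow>
     \<exists>a<q. \<forall>k<d - 1. cmod (\<omega> k * e (of_int (int a * g ^ k) / of_nat q) - 1) < \<eta>"
    using powers_dense_mod[OF assms(1) \<eta>] by blast
  have "\<exists>a\<in>{0..<int q}. kloosterman a b q d \<in> ball w \<epsilon>"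
    if pq: "prime p" "\<alpha> \<ge> 1" "q = p ^ \<alpha>" "odd q" "[p = 1] (mod d)" "q \<ge> Q" for q p \<alpha> :: nat
  proof -
    obtain g :: int where g: "int q dvd (\<Sum>k<d. g ^ k)"
      "\<And>a b. kloosterman a b q d = (\<Sum>k<d. e (of_int (a * g ^ k + b * g ^ (d - k)) / of_nat q))"
      using kloosterman_prime_power[OF assms(1) pq(1-5)] by metis
    have q: "q > 0" using pq(4) by (rule odd_pos)
    \<comment> \<open>The fixed phase absorbs the \<open>b\<close> term and the target:
      \<open>\<omega> k\<close> times the \<open>a\<close> term is \<open>z k * cnj (y k)\<close>,
      which is near 1 exactly when \<open>z k\<close> is near \<open>y k\<close>.\<close>
    define \<omega> where "\<omega> = (\<lambda>k. e (of_int (b * g ^ (d - k)) / of_nat q) * cnj (y k))"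
    obtain a where a: "a < q"
      "\<And>k. k < n \<Longrightarrow> cmod (\<omega> k * e (of_int (int a * g ^ k) / of_nat q) - 1) < \<eta>"
      using Q[OF pq(6) q g(1), of \<omega>] y(2) by (auto simp: \<omega>_def norm_mult n)
    define z where "z = (\<lambda>k. e (of_int (int a * g ^ k + b * g ^ (d - k)) / of_nat q))"
    have "cmod (y k - z k) \<le> \<eta>" if k: "k < n" for k
    proof -
      have unit: "cmod (y k) = 1" using y(2) k n by simp
      hence "cnj (y k) * y k = 1"
        unfolding mult.commute[of "cnj (y k)"] complex_norm_square[symmetric] by simp
      hence "z k - y k = (\<omega> k * e (of_int (int a * g ^ k) / of_nat q) - 1) * y k"
        by (simp add: z_def \<omega>_def add_divide_distrib e_add ring_distribs mult_ac)
      hence "cmod (z k - y k) = cmod (\<omega> k * e (of_int (int a * g ^ k) / of_nat q) - 1)"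
        using unit by (simp add: norm_mult)
      thus ?thesis using a(2)[OF k] by (simp add: norm_minus_commute)
    qed
    moreover have "(\<Prod>k<d. z k) = 1"
      unfolding z_def by (rule prod_e_eq_1[OF q sum_powers_dvd[OF g(1)]])
    ultimately have "cmod (w - (\<Sum>k<d. z k)) \<le> 2 * real n * \<eta>"
      using dist_unit_sums_le[of n y z \<eta>] y unfolding n by (simp add: z_def)
    hence "kloosterman (int a) b q d \<in> ball w \<epsilon>"
      using \<eta>' unfolding g(2) z_def by (simp add: dist_norm)
    thus ?thesis using a(1) by (intro bexI[of _ "int a"]) auto
  qed
  thus ?thesis by blast
qed

theorem theorem2:
  fixes d :: nat
  assumes "prime d" and "odd d"
  shows
    "(\<forall>(q::nat) (p::nat) (\<alpha>::nat) (a::int) (b::int).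
        prime p \<and> \<alpha> \<ge> 1 \<and> q = p ^ \<alpha> \<and> odd q \<and> [p = 1] (mod d) \<longrightarrow>
          kloosterman a b q d \<in> hypocycloid_region d) \<and>
     (\<forall>(\<epsilon>::real) (b::int) (w::complex).
        \<epsilon> > 0 \<and> w \<in> hypocycloid_region d \<longrightarrow>
          (\<exists>Q::nat. \<forall>(q::nat) (p::nat) (\<alpha>::nat).
             prime p \<and> \<alpha> \<ge> 1 \<and> q = p ^ \<alpha> \<and> odd q \<and> [p = 1] (mod d) \<and> q \<ge> Q \<longrightarrow>
               (\<exists>a\<in>{0..<int q}. kloosterman a b q d \<in> ball w \<epsilon>)))"
proof -
  have "d \<noteq> 2" using assms(2) by auto
  hence "d \<ge> 3" using prime_ge_2_nat[OF assms(1)] by linarith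
  hence region: "hypocycloid_region d = unit_sums d"
    using assms(2) by (rule hypocycloid_region_eq_unit_sums)
  have "kloosterman a b q d \<in> unit_sums d"
    if pq: "prime p" "\<alpha> \<ge> 1" "q = p ^ \<alpha>" "odd q" "[p = 1] (mod d)" for q p \<alpha> :: nat and a b
  proof -
    obtain g :: int where g: "int q dvd (\<Sum>k<d. g ^ k)"
      "\<And>a b. kloosterman a b q d = (\<Sum>k<d. e (of_int (a * g ^ k + b * g ^ (d - k)) / of_nat q))"
      using kloosterman_prime_power[OF assms(1) pq] by metis
    show ?thesis
      unfolding g(2)
      by (intro unit_sumsI prod_e_eq_1 sum_powers_dvd[OF g(1)] odd_pos[OF pq(4)]) simp
  qed
  thus ?thesis
    unfolding region using kloosterman_dense_unit_sums[OF assms(1)] by blast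
qed

end
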